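(* Let $L$ be a smooth closed Lagrangian submanifold of $(\mathbb R^{2m},\omega=\sum_{i=1}^m dp_i\wedge dq_i)$, let $\lambda\in\mathbb R\setminus\{0,1\}$, and let $a^+,a^-\in L$ be a $k$-parallel pair. Let $L^\pm$ denote the germ of $L$ at $a^\pm$, and suppose that $$L^+:\ p_i=\frac{\partial S^+}{\partial q_i}(q_1,\dots,q_m),\quad i=1,\dots,m,$$ $$L^-:\ \begin{cases}p_j=\frac{\partial S^-}{\partial q_j}(q_1,\dots,q_k,p_{k+1},\dots,p_m),& j=1,\dots,k,\\ q_l=-\frac{\partial S^-}{\partial p_l}(q_1,\dots,q_k,p_{k+1},\dots,p_m),& l=k+1,\dots,m,\end{cases}$$ where $S^+$ and $S^-$ are smooth function-germs whose second differentials vanish at the points corresponding to $a^+$ and $a^-$ respectively. Then the germ of the generating family $$F_\lambda(p,q,\alpha_{[m]\setminus[k]},\beta)=2\lambda^2S^+\!\left(\tfrac{q+\beta}{2\lambda}\right)-2(1-\lambda)^2S^-\!\left(\tfrac{q_{[k]}-\beta_{[k]},\ p_{[m]\setminus[k]}-\alpha_{[m]\setminus[k]}}{2(1-\lambda)}\right)-\sum_{i=1}^k p_i\beta_i+\tfrac12\sum_{j=k+1}^m\left(q_j\alpha_j-p_j\beta_j-\alpha_j\beta_j-p_jq_j\right)$$ generates the germ of $\mathcal L_\lambda=\Phi_\lambda(L^+\times L^-)$ at $(a,\dot a)$, where $a=\lambda a^++(1-\lambda)a^-$ and $\dot a=\lambda a^+-(1-\lambda)a^-$, in the following way: $$\mathcal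 L_\lambda=\left\{(\dot p,\dot q,p,q):\ \exists(\alpha,\beta)\ \ \dot p=\frac{\partial F_\lambda}{\partial q},\ \dot q=-\frac{\partial F_\lambda}{\partial p},\ \frac{\partial F_\lambda}{\partial\alpha}=\frac{\partial F_\lambda}{\partial\beta}=0\right\}.$$
   Context: A pair $a^+\ne a^-$ of points of $L$ is weakly parallel if $T_{a^+}L+\tau_{a^+-a^-}(T_{a^-}L)\ne T_{a^+}\mathbb R^{2m}$, where $\tau_v$ is translation by $v$. It is $k$-parallel if in addition $\dim(T_{a^+}L\cap\tau_{a^+-a^-}(T_{a^-}L))=k$, so $1\le k\le m$. The $\lambda$-chord transformation is the linear diffeomorphism $\Phi_\lambda:\mathbb R^{2m}\times\mathbb R^{2m}\to T\mathbb R^{2m}$, $(x^+,x^-)\mapsto(x,\dot x)$, with $x=\lambda x^++(1-\lambda)x^-$ and $\dot x=\lambda x^+-(1-\lambda)x^-$. Coordinates on $T\mathbb R^{2m}$ are $(p,q,\dot p,\dot q)$. Notation: $[k]=\{1,\dots,k\}$; $q=(q_1,\dots,q_m)$, $p=(p_1,\dots,p_m)$, $\beta=(\beta_1,\dots,\beta_m)$; $\beta_{[k]}=(\beta_1,\dots,\beta_k)$; $\alpha_{[m]\setminus[k]}=(\alpha_{k+1},\dots,\alpha_m)$, and similarly for the other variables. When $k=m$ the variables $\alpha$ and the last sum are absent. The germ of $F_\lambda$ is taken at $(p,q)=a$, $\alpha_{[m]\setminus[k]}=\dot p_{a,[m]\setminus[k]}$, $\beta=\dot q_a$, where $\dot a=(\dot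 p_a,\dot q_a)$. *)

theory Defs
  imports "HOL-Analysis.Analysis"
begin

section \<open>Smooth maps, partial derivatives and germs\<close>

text \<open>On an open set of a Euclidean space, \<open>n\<close>-fold continuous differentiability may be tested on the
  directional derivatives. These predicates are only used on open sets.\<close>

fun C_n_on :: "nat \<Rightarrow> 'a::euclidean_space set \<Rightarrow> ('a \<Rightarrow> 'b::real_normed_vector) \<Rightarrow> bool" where
  "C_n_on 0 U f \<longleftrightarrow> continuous_on U f"
| "C_n_on (Suc n) U f \<longleftrightarrow> (\<forall>x\<in>U. f differentiable (at x)) \<and>
      (\<forall>v. C_n_on n U (\<lambda>x. frechet_derivative f (at x) v))"

definition smooth_on :: "'a::euclidean_space set \<Rightarrow> ('a \<Rightarrow> 'b::real_normed_vector) \<Rightarrow> bool" where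
  "smooth_on U f \<longleftrightarrow> (\<forall>n. C_n_on n U f)"

text \<open>A function germ at \<open>x\<close> is represented by a total function; its values far from \<open>x\<close> are arbitrary.\<close>

definition smooth_germ_at :: "'a::euclidean_space \<Rightarrow> ('a \<Rightarrow> 'b::real_normed_vector) \<Rightarrow> bool" where
  "smooth_germ_at x f \<longleftrightarrow> (\<exists>U. open U \<and> x \<in> U \<and> smooth_on U f)"

type_synonym 'm rvec = "(real, 'm) vec"

definition partial :: "'m::finite \<Rightarrow> ('m rvec \<Rightarrow> real) \<Rightarrow> 'm rvec \<Rightarrow> real" where
  "partial i f x = deriv (\<lambda>t. f (x + t *\<^sub>R axis i 1)) 0"

definition second_differential :: "('m::finite rvec \<Rightarrow> real) \<Rightarrow> 'm rvec \<Rightarrow> 'm rvec \<Rightarrow> 'm rvec \<Rightarrow> real" where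
  "second_differential f x u v =
     frechet_derivative (\<lambda>y. frechet_derivative f (at y) u) (at x) v"

definition set_germ_eq :: "'a::topological_space \<Rightarrow> 'a set \<Rightarrow> 'a set \<Rightarrow> bool" where
  "set_germ_eq x A B \<longleftrightarrow> (\<forall>\<^sub>F y in nhds x. y \<in> A \<longleftrightarrow> y \<in> B)"

section \<open>Lagrangian submanifolds and parallel pairs\<close>

text \<open>Embedded, without boundary, via slice charts.\<close>

definition smooth_submanifold :: "nat \<Rightarrow> 'a::euclidean_space set \<Rightarrow> bool" where
  "smooth_submanifold d L \<longleftrightarrow>
     (\<forall>x\<in>L. \<exists>U \<phi> \<psi> S. open U \<and> x \<in> U \<and> open (\<phi> ` U) \<and>
        smooth_on U \<phi> \<and> smooth_on (\<phi> ` U) \<psi> \<and> (\<forall>y\<in>U. \<psi> (\<phi> y) = y) \<and>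
        subspace (S :: 'a set) \<and> dim S = d \<and> \<phi> ` (L \<inter> U) = \<phi> ` U \<inter> S)"

text \<open>Tangent vectors of the ambient space at any point are identified with vectors of that space.
  Under this identification, translations act on tangent vectors as the identity.\<close>

definition tangent_space :: "'a::euclidean_space set \<Rightarrow> 'a \<Rightarrow> 'a set" where
  "tangent_space L x = {v. \<exists>\<gamma> \<epsilon>. \<epsilon> > 0 \<and> smooth_on {-\<epsilon><..<\<epsilon>} \<gamma> \<and> \<gamma> ` {-\<epsilon><..<\<epsilon>} \<subseteq> L \<and>
     \<gamma> 0 = x \<and> (\<gamma> has_vector_derivative v) (at (0::real))}"

text \<open>Points of \<open>\<real>\<^sup>2\<^sup>m\<close> are pairs \<open>(p, q)\<close>, where \<open>m = CARD('m)\<close>.\<close>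

type_synonym 'm phase = "'m rvec \<times> 'm rvec"

definition omega :: "'m::finite phase \<Rightarrow> 'm phase \<Rightarrow> real" where
  "omega u v = (\<Sum>i\<in>UNIV. fst u $ i * snd v $ i - fst v $ i * snd u $ i)"

definition lagrangian_submanifold :: "'m::finite phase set \<Rightarrow> bool" where
  "lagrangian_submanifold L \<longleftrightarrow> smooth_submanifold CARD('m) L \<and>
     (\<forall>x\<in>L. \<forall>u\<in>tangent_space L x. \<forall>v\<in>tangent_space L x. omega u v = 0)"

definition weakly_parallel :: "'m::finite phase set \<Rightarrow> 'm phase \<Rightarrow> 'm phase \<Rightarrow> bool" where
  "weakly_parallel L ap am \<longleftrightarrow> ap \<in> L \<and> am \<in> L \<and> ap \<noteq> am \<and>
     {u + v | u v. u \<in> tangent_space L ap \<and> v \<in> tangent_space L am} \<noteq> UNIV"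

definition k_parallel :: "nat \<Rightarrow> 'm::finite phase set \<Rightarrow> 'm phase \<Rightarrow> 'm phase \<Rightarrow> bool" where
  "k_parallel k L ap am \<longleftrightarrow> weakly_parallel L ap am \<and>
     dim (tangent_space L ap \<inter> tangent_space L am) = k"

section \<open>The chord transformation and generating families\<close>

text \<open>Points of the tangent bundle are written \<open>((p, q), (p', q'))\<close>, base point first.\<close>

definition chord_map :: "real \<Rightarrow> 'm::finite phase \<times> 'm phase \<Rightarrow> 'm phase \<times> 'm phase" where
  "chord_map lam = (\<lambda>(xp, xm). (lam *\<^sub>R xp + (1 - lam) *\<^sub>R xm, lam *\<^sub>R xp - (1 - lam) *\<^sub>R xm))"

text \<open>The index type is linearly ordered, and its \<open>i\<close>-th smallest element plays the role of the
  index \<open>i\<close>. So \<open>idx k\<close> is the set \<open>{1, \<dots>, k}\<close>.\<close>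

definition idx :: "nat \<Rightarrow> 'm::{finite,linorder} set" where
  "idx k = {i. card {..i} \<le> k}"

definition mix :: "nat \<Rightarrow> 'm::{finite,linorder} rvec \<Rightarrow> 'm rvec \<Rightarrow> 'm rvec" where
  "mix k q p = (\<chi> i. if i \<in> idx k then q $ i else p $ i)"

definition graph_q :: "('m::finite rvec \<Rightarrow> real) \<Rightarrow> 'm phase set" where
  "graph_q S = {(p, q). \<forall>i. p $ i = partial i S q}"

definition graph_mix :: "nat \<Rightarrow> ('m::{finite,linorder} rvec \<Rightarrow> real) \<Rightarrow> 'm phase set" where
  "graph_mix k S = {(p, q). (\<forall>j\<in>idx k. p $ j = partial j S (mix k q p)) \<and>
                            (\<forall>l\<in>- idx k. q $ l = - partial l S (mix k q p))}"

text \<open>The variables \<open>\<alpha>\<close> indexed by \<open>{k+1, \<dots>, m}\<close> are the vectors whose coordinates in \<open>idx k\<close> vanish.\<close>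

definition alpha_space :: "nat \<Rightarrow> ('m::{finite,linorder} rvec) set" where
  "alpha_space k = {\<alpha>. \<forall>i\<in>idx k. \<alpha> $ i = 0}"

definition F_fam :: "nat \<Rightarrow> real \<Rightarrow> ('m::{finite,linorder} rvec \<Rightarrow> real) \<Rightarrow> ('m rvec \<Rightarrow> real) \<Rightarrow>
    'm rvec \<Rightarrow> 'm rvec \<Rightarrow> 'm rvec \<Rightarrow> 'm rvec \<Rightarrow> real" where
  "F_fam k lam Sp Sm p q \<alpha> \<beta> =
     2 * lam\<^sup>2 * Sp ((q + \<beta>) /\<^sub>R (2 * lam))
     - 2 * (1 - lam)\<^sup>2 * Sm (mix k (q - \<beta>) (p - \<alpha>) /\<^sub>R (2 * (1 - lam)))
     - (\<Sum>i\<in>idx k. p $ i * \<beta> $ i)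
     + 1/2 * (\<Sum>j\<in>- idx k. q $ j * \<alpha> $ j - p $ j * \<beta> $ j - \<alpha> $ j * \<beta> $ j - p $ j * q $ j)"

definition generated_set :: "nat \<Rightarrow>
    ('m::{finite,linorder} rvec \<Rightarrow> 'm rvec \<Rightarrow> 'm rvec \<Rightarrow> 'm rvec \<Rightarrow> real) \<Rightarrow>
    ('m rvec \<times> 'm rvec \<times> 'm rvec \<times> 'm rvec) set \<Rightarrow> ('m phase \<times> 'm phase) set" where
  "generated_set k F W = {((p, q), (p', q')). \<exists>\<alpha> \<in> alpha_space k. \<exists>\<beta>. (p, q, \<alpha>, \<beta>) \<in> W \<and>
     (\<forall>i. p' $ i = partial i (\<lambda>q. F p q \<alpha> \<beta>) q) \<and>
     (\<forall>i. q' $ i = - partial i (\<lambda>p. F p q \<alpha> \<beta>) p) \<and>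
     (\<forall>j\<in>- idx k. partial j (\<lambda>\<alpha>. F p q \<alpha> \<beta>) \<alpha> = 0) \<and>
     (\<forall>i. partial i (\<lambda>\<beta>. F p q \<alpha> \<beta>) \<beta> = 0)}"

text \<open>The germ of \<open>F\<close> at \<open>b\<close> generates the germ of \<open>M\<close> at \<open>z\<close>: every representative of \<open>F\<close> with
  sufficiently small domain \<open>W\<close> generates a set having the same germ at \<open>z\<close> as \<open>M\<close>.\<close>

definition generates_germ :: "nat \<Rightarrow>
    ('m::{finite,linorder} rvec \<Rightarrow> 'm rvec \<Rightarrow> 'm rvec \<Rightarrow> 'm rvec \<Rightarrow> real) \<Rightarrow>
    'm rvec \<times> 'm rvec \<times> 'm rvec \<times> 'm rvec \<Rightarrow>
    ('m phase \<times> 'm phase) set \<Rightarrow> 'm phase \<times> 'm phase \<Rightarrow> bool" where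
  "generates_germ k F b M z \<longleftrightarrow>
     (\<exists>W0. open W0 \<and> b \<in> W0 \<and>
       (\<forall>W. open W \<and> b \<in> W \<and> W \<subseteq> W0 \<longrightarrow> set_germ_eq z M (generated_set k F W)))"

end

theory Submission
  imports Defs
begin

text \<open>
  The chord transformation is inverted by \<open>x\<^sup>+ = (x + x') / (2 \<lambda>)\<close> and
  \<open>x\<^sup>- = (x - x') / (2 (1 - \<lambda>))\<close>. Hence near \<open>(a, a')\<close> its image is cut out by two
  conditions: \<open>x\<^sup>+\<close> lies on the graph given by \<open>S\<^sup>+\<close>, and \<open>x\<^sup>-\<close> on the mixed graph given by \<open>S\<^sup>-\<close>.

  On the other side, the partial derivatives of \<open>F\<^sub>\<lambda>\<close> are affine in the first derivatives of
  \<open>S\<^sup>+\<close> and \<open>S\<^sup>-\<close>, taken at the points \<open>(q + \<beta>) / (2 \<lambda>)\<close> and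
  \<open>((q - \<beta>)\<^bsub>[k]\<^esub>, (p - \<alpha>)\<^bsub>[m] - [k]\<^esub>) / (2 (1 - \<lambda>))\<close>. Eliminating these derivatives
  from the generating equations leaves \<open>\<beta> = q'\<close> and \<open>\<alpha>\<^sub>j = p'\<^sub>j\<close> for \<open>j > k\<close>: the parameters are
  fibre coordinates. After this substitution the two points are precisely the arguments at which
  the graph equations of \<open>x\<^sup>+\<close> and \<open>x\<^sup>-\<close> evaluate the derivatives of \<open>S\<^sup>+\<close> and \<open>S\<^sup>-\<close>, and the
  remaining equations are those graph equations, up to an invertible linear combination
  (lemma \<open>generating_equations_iff\<close>).

  This is an identity of sets wherever \<open>S\<^sup>+\<close> and \<open>S\<^sup>-\<close> are differentiable at the two points.
  That condition defines the neighbourhood \<open>W0\<close> of the base point of the family. A smaller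
  domain \<open>W\<close> adds only the condition \<open>(p, q, \<alpha>, \<beta>) \<in> W\<close>, and near \<open>(a, a')\<close> this holds
  automatically, because the parameters depend continuously on the point of the tangent bundle.
\<close>

section \<open>Germs and the chord transformation\<close>

lemma smooth_on_imp_differentiable:
  assumes "smooth_on U f" "x \<in> U"
  shows "f differentiable (at x)"
proof -
  have "C_n_on (Suc 0) U f"
    using assms(1) unfolding smooth_on_def by blast
  then show ?thesis
    using assms(2) by simp
qed

lemma set_germ_eq_vimage:
  assumes "continuous_on UNIV f" "set_germ_eq (f x) A B"
  shows "set_germ_eq x (f -` A) (f -` B)"
proof -
  obtain U where U: "open U" "f x \<in> U" "\<forall>y\<in>U. y \<in> A \<longleftrightarrow> y \<in> B"
    using assms(2) unfolding set_germ_eq_def eventually_nhds by blast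
  have "open (f -` U)"
    using U(1) assms(1) by (rule open_vimage)
  then show ?thesis
    using U unfolding set_germ_eq_def eventually_nhds by (intro exI[of _ "f -` U"]) auto
qed

definition head :: "real \<Rightarrow> 'm::finite phase \<times> 'm phase \<Rightarrow> 'm phase" where
  "head lam = (\<lambda>(x, x'). (x + x') /\<^sub>R (2 * lam))"

definition tail :: "real \<Rightarrow> 'm::finite phase \<times> 'm phase \<Rightarrow> 'm phase" where
  "tail lam = (\<lambda>(x, x'). (x - x') /\<^sub>R (2 * (1 - lam)))"

lemma continuous_on_head: "continuous_on A (head lam)"
  unfolding head_def case_prod_unfold by (intro continuous_intros)

lemma continuous_on_tail: "continuous_on A (tail lam)"
  unfolding tail_def case_prod_unfold by (intro continuous_intros)

lemma head_chord_map: "lam \<noteq> 0 \<Longrightarrow> head lam (chord_map lam (xp, xm)) = xp"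
  by (simp add: head_def chord_map_def flip: scaleR_2)

lemma tail_chord_map: "lam \<noteq> 1 \<Longrightarrow> tail lam (chord_map lam (xp, xm)) = xm"
  by (simp add: tail_def chord_map_def flip: scaleR_2)

lemma chord_map_head_tail:
  assumes "lam \<noteq> 0" "lam \<noteq> 1"
  shows "chord_map lam (head lam z, tail lam z) = z"
proof -
  obtain x x' where z: "z = (x, x')"
    by (cases z)
  have half: "(1/2) *\<^sub>R (x + x') + (1/2) *\<^sub>R (x - x') = x"
    "(1/2) *\<^sub>R (x + x') - (1/2) *\<^sub>R (x - x') = x'"
    by (simp_all add: algebra_simps flip: scaleR_add_left)
  have "lam *\<^sub>R head lam z = (1/2) *\<^sub>R (x + x')"
    "(1 - lam) *\<^sub>R tail lam z = (1/2) *\<^sub>R (x - x')"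
    using assms by (simp_all add: head_def tail_def z inverse_eq_divide)
  then show ?thesis
    using half by (simp add: chord_map_def flip: z)
qed

lemma chord_map_image:
  assumes "lam \<noteq> 0" "lam \<noteq> 1"
  shows "chord_map lam ` (A \<times> B) = head lam -` A \<inter> tail lam -` B"
proof (intro equalityI subsetI)
  fix z assume "z \<in> chord_map lam ` (A \<times> B)"
  then show "z \<in> head lam -` A \<inter> tail lam -` B"
    using assms by (auto simp: head_chord_map tail_chord_map)
next
  fix z assume "z \<in> head lam -` A \<inter> tail lam -` B"
  then show "z \<in> chord_map lam ` (A \<times> B)"
    by (intro image_eqI[where x = "(head lam z, tail lam z)"]) (auto simp: chord_map_head_tail assms)
qed

section \<open>Partial derivatives of the generating family\<close>

lemma partial_eqI:
  "((\<lambda>t. f (x + t *\<^sub>R axis i 1)) has_real_derivative D) (at 0) \<Longrightarrow> partial i f x = D"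
  unfolding partial_def by (rule DERIV_imp_deriv)

text \<open>Each variable of \<open>F\<^sub>\<lambda>\<close> moves the arguments of \<open>S\<^sup>+\<close> and \<open>S\<^sup>-\<close> along a coordinate line with some
  constant speed \<open>c\<close>.\<close>

lemma has_real_derivative_along_axis:
  assumes "f differentiable (at x)"
  shows "((\<lambda>t. f (x + (c * t) *\<^sub>R axis i 1)) has_real_derivative c * partial i f x) (at 0)"
proof -
  obtain f' where f': "(f has_derivative f') (at x)"
    using assms unfolding differentiable_def by blast
  then interpret bounded_linear f'
    by (rule has_derivative_bounded_linear)
  have line: "((\<lambda>t. f (x + (d * t) *\<^sub>R axis i 1)) has_real_derivative d * f' (axis i 1)) (at 0)" for d
  proof -
    have "((\<lambda>t. x + (d * t) *\<^sub>R axis i (1::real)) has_derivative (\<lambda>t. (d * t) *\<^sub>R axis i 1)) (at 0)"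
      by (auto intro!: derivative_eq_intros)
    from has_derivative_compose[OF this, of f f'] f'
    have "((\<lambda>t. f (x + (d * t) *\<^sub>R axis i 1)) has_derivative (\<lambda>t. f' ((d * t) *\<^sub>R axis i 1))) (at 0)"
      by simp
    moreover have "(\<lambda>t. f' ((d * t) *\<^sub>R axis i 1)) = (*) (d * f' (axis i 1))"
      by (simp add: fun_eq_iff scaleR)
    ultimately show ?thesis
      unfolding has_field_derivative_def by simp
  qed
  have "partial i f x = f' (axis i 1)"
    using line[of 1] by (intro partial_eqI) simp
  then show ?thesis
    using line[of c] by simp
qed

definition plus_arg :: "real \<Rightarrow> 'm::finite rvec \<Rightarrow> 'm rvec \<Rightarrow> 'm rvec" where
  "plus_arg lam q \<beta> = (q + \<beta>) /\<^sub>R (2 * lam)"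

definition minus_arg ::
    "nat \<Rightarrow> real \<Rightarrow> 'm::{finite,linorder} rvec \<Rightarrow> 'm rvec \<Rightarrow> 'm rvec \<Rightarrow> 'm rvec \<Rightarrow> 'm rvec" where
  "minus_arg k lam p q \<alpha> \<beta> = mix k (q - \<beta>) (p - \<alpha>) /\<^sub>R (2 * (1 - lam))"

lemma plus_arg_shift:
  "plus_arg lam (q + t *\<^sub>R e) \<beta> = plus_arg lam q \<beta> + (1 / (2 * lam) * t) *\<^sub>R e"
  "plus_arg lam q (\<beta> + t *\<^sub>R e) = plus_arg lam q \<beta> + (1 / (2 * lam) * t) *\<^sub>R e"
  by (simp_all add: plus_arg_def scaleR_add_right inverse_eq_divide)

lemma minus_arg_shift:
  "minus_arg k lam p (q + t *\<^sub>R axis i 1) \<alpha> \<beta> = minus_arg k lam p q \<alpha> \<beta> +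
     ((if i \<in> idx k then 1 else 0) / (2 * (1 - lam)) * t) *\<^sub>R axis i 1"
  "minus_arg k lam p q \<alpha> (\<beta> + t *\<^sub>R axis i 1) = minus_arg k lam p q \<alpha> \<beta> +
     ((if i \<in> idx k then - 1 else 0) / (2 * (1 - lam)) * t) *\<^sub>R axis i 1"
  "minus_arg k lam (p + t *\<^sub>R axis i 1) q \<alpha> \<beta> = minus_arg k lam p q \<alpha> \<beta> +
     ((if i \<in> idx k then 0 else 1) / (2 * (1 - lam)) * t) *\<^sub>R axis i 1"
  "minus_arg k lam p q (\<alpha> + t *\<^sub>R axis i 1) \<beta> = minus_arg k lam p q \<alpha> \<beta> +
     ((if i \<in> idx k then 0 else - 1) / (2 * (1 - lam)) * t) *\<^sub>R axis i 1"
  by (auto simp: minus_arg_def mix_def vec_eq_iff axis_def algebra_simps divide_inverse)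

text \<open>The two sums of \<open>F\<^sub>\<lambda>\<close> are merged into one, so that moving a variable along the \<open>i\<close>-th coordinate
  line changes at most one summand.\<close>

definition quadratic_part ::
    "nat \<Rightarrow> 'm::{finite,linorder} rvec \<Rightarrow> 'm rvec \<Rightarrow> 'm rvec \<Rightarrow> 'm rvec \<Rightarrow> real" where
  "quadratic_part k p q \<alpha> \<beta> = (\<Sum>j\<in>UNIV. if j \<in> idx k then - (p $ j * \<beta> $ j)
     else (q $ j * \<alpha> $ j - p $ j * \<beta> $ j - \<alpha> $ j * \<beta> $ j - p $ j * q $ j) / 2)"

lemma F_fam_eq:
  "F_fam k lam Sp Sm p q \<alpha> \<beta> =
     2 * lam\<^sup>2 * Sp (plus_arg lam q \<beta>) - 2 * (1 - lam)\<^sup>2 * Sm (minus_arg k lam p q \<alpha> \<beta>)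
     + quadratic_part k p q \<alpha> \<beta>"
  by (simp add: F_fam_def plus_arg_def minus_arg_def quadratic_part_def sum.If_cases
      sum_negf sum_divide_distrib Compl_eq)

lemma sum_UNIV_change_at:
  fixes f g :: "'m::finite \<Rightarrow> real"
  assumes "\<And>j. f j = g j + (if j = i then d else 0)"
  shows "sum f UNIV = sum g UNIV + d"
  by (simp add: assms sum.distrib)

lemma quadratic_part_shift:
  "quadratic_part k p (q + t *\<^sub>R axis i 1) \<alpha> \<beta> = quadratic_part k p q \<alpha> \<beta> +
     (if i \<in> idx k then 0 else (\<alpha> $ i - p $ i) / 2) * t"
  "quadratic_part k p q \<alpha> (\<beta> + t *\<^sub>R axis i 1) = quadratic_part k p q \<alpha> \<beta> +
     (if i \<in> idx k then - p $ i else - (p $ i + \<alpha> $ i) / 2) * t"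
  "quadratic_part k (p + t *\<^sub>R axis i 1) q \<alpha> \<beta> = quadratic_part k p q \<alpha> \<beta> +
     (if i \<in> idx k then - \<beta> $ i else - (\<beta> $ i + q $ i) / 2) * t"
  "quadratic_part k p q (\<alpha> + t *\<^sub>R axis i 1) \<beta> = quadratic_part k p q \<alpha> \<beta> +
     (if i \<in> idx k then 0 else (q $ i - \<beta> $ i) / 2) * t"
  unfolding quadratic_part_def
  by (rule sum_UNIV_change_at; auto simp: axis_def field_simps)+

context
  fixes k :: nat and lam :: real and Sp Sm :: "'m::{finite,linorder} rvec \<Rightarrow> real"
    and p q \<alpha> \<beta> :: "'m rvec"
  assumes lam: "lam \<noteq> 0" "lam \<noteq> 1"
    and Sp: "Sp differentiable (at (plus_arg lam q \<beta>))"
    and Sm: "Sm differentiable (at (minus_arg k lam p q \<alpha> \<beta>))"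
begin

text \<open>All four kinds of partial derivatives of \<open>F\<^sub>\<lambda>\<close> are instances of the following formula. The
  factors \<open>2 \<lambda>\<^sup>2\<close> and \<open>2 (1 - \<lambda>)\<^sup>2\<close> of \<open>F\<^sub>\<lambda>\<close> meet the speeds \<open>c / (2 \<lambda>)\<close> and
  \<open>d / (2 (1 - \<lambda>))\<close> of the arguments, which leaves \<open>\<lambda> c\<close> and \<open>(1 - \<lambda>) d\<close>.\<close>

lemma partial_of_shifted_arguments:
  assumes f: "\<And>t. f (x + t *\<^sub>R axis i 1) =
      2 * lam\<^sup>2 * Sp (plus_arg lam q \<beta> + (c / (2 * lam) * t) *\<^sub>R axis i 1)
      - 2 * (1 - lam)\<^sup>2 * Sm (minus_arg k lam p q \<alpha> \<beta> + (d / (2 * (1 - lam)) * t) *\<^sub>R axis i 1)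
      + (b + e * t)"
  shows "partial i f x = lam * c * partial i Sp (plus_arg lam q \<beta>)
      - (1 - lam) * d * partial i Sm (minus_arg k lam p q \<alpha> \<beta>) + e"
proof -
  let ?P = "partial i Sp (plus_arg lam q \<beta>)" and ?M = "partial i Sm (minus_arg k lam p q \<alpha> \<beta>)"
  have linear: "((\<lambda>t. b + e * t) has_real_derivative e) (at 0)"
    by (auto intro!: derivative_eq_intros)
  have factor: "2 * r\<^sup>2 * (s / (2 * r) * D) = r * s * D" if "r \<noteq> 0" for r s D :: real
    using that by (simp add: power2_eq_square)
  have "1 - lam \<noteq> 0"
    using lam by simp
  have "partial i f x = 2 * lam\<^sup>2 * (c / (2 * lam) * ?P)
      - 2 * (1 - lam)\<^sup>2 * (d / (2 * (1 - lam)) * ?M) + e"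
    by (rule partial_eqI, unfold f)
      (intro DERIV_add[OF DERIV_diff[OF DERIV_cmult DERIV_cmult] linear]
        has_real_derivative_along_axis[OF Sp] has_real_derivative_along_axis[OF Sm])
  then show ?thesis
    unfolding factor[OF \<open>lam \<noteq> 0\<close>] factor[OF \<open>1 - lam \<noteq> 0\<close>] .
qed

lemma partial_q_F_fam:
  "partial i (\<lambda>q. F_fam k lam Sp Sm p q \<alpha> \<beta>) q =
     lam * partial i Sp (plus_arg lam q \<beta>) +
     (if i \<in> idx k then - (1 - lam) * partial i Sm (minus_arg k lam p q \<alpha> \<beta>)
      else (\<alpha> $ i - p $ i) / 2)"
  by (rule trans[OF partial_of_shifted_arguments
      [where c = 1 and d = "if i \<in> idx k then 1 else 0"
        and e = "if i \<in> idx k then 0 else (\<alpha> $ i - p $ i) / 2"]])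
    (simp only: F_fam_eq plus_arg_shift minus_arg_shift quadratic_part_shift, simp add: algebra_simps)

lemma partial_p_F_fam:
  "partial i (\<lambda>p. F_fam k lam Sp Sm p q \<alpha> \<beta>) p =
     (if i \<in> idx k then - \<beta> $ i
      else - (1 - lam) * partial i Sm (minus_arg k lam p q \<alpha> \<beta>) - (\<beta> $ i + q $ i) / 2)"
  by (rule trans[OF partial_of_shifted_arguments
      [where c = 0 and d = "if i \<in> idx k then 0 else 1"
        and e = "if i \<in> idx k then - \<beta> $ i else - (\<beta> $ i + q $ i) / 2"]])
    (simp only: F_fam_eq minus_arg_shift quadratic_part_shift, simp, simp add: field_simps)

lemma partial_\<alpha>_F_fam:
  "partial i (\<lambda>\<alpha>. F_fam k lam Sp Sm p q \<alpha> \<beta>) \<alpha> =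
     (if i \<in> idx k then 0
      else (1 - lam) * partial i Sm (minus_arg k lam p q \<alpha> \<beta>) + (q $ i - \<beta> $ i) / 2)"
  by (rule trans[OF partial_of_shifted_arguments
      [where c = 0 and d = "if i \<in> idx k then 0 else - 1"
        and e = "if i \<in> idx k then 0 else (q $ i - \<beta> $ i) / 2"]])
    (simp only: F_fam_eq minus_arg_shift quadratic_part_shift, simp, simp add: field_simps)

lemma partial_\<beta>_F_fam:
  "partial i (\<lambda>\<beta>. F_fam k lam Sp Sm p q \<alpha> \<beta>) \<beta> =
     lam * partial i Sp (plus_arg lam q \<beta>) +
     (if i \<in> idx k then (1 - lam) * partial i Sm (minus_arg k lam p q \<alpha> \<beta>) - p $ i
      else - (p $ i + \<alpha> $ i) / 2)"
  by (rule trans[OF partial_of_shifted_arguments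
      [where c = 1 and d = "if i \<in> idx k then - 1 else 0"
        and e = "if i \<in> idx k then - p $ i else - (p $ i + \<alpha> $ i) / 2"]])
    (simp only: F_fam_eq plus_arg_shift minus_arg_shift quadratic_part_shift, simp add: algebra_simps)

section \<open>The set generated by the family\<close>

text \<open>For \<open>j > k\<close>, subtracting the \<open>\<beta>\<^sub>j\<close>-equation from the \<open>q\<^sub>j\<close>-equation eliminates \<open>S\<^sup>+\<close> and gives
  \<open>\<alpha>\<^sub>j = p'\<^sub>j\<close>, and subtracting the \<open>\<alpha>\<^sub>j\<close>-equation from the \<open>p\<^sub>j\<close>-equation eliminates \<open>S\<^sup>-\<close> and
  gives \<open>\<beta>\<^sub>j = q'\<^sub>j\<close>; the \<open>\<beta>\<^sub>j\<close>- and \<open>\<alpha>\<^sub>j\<close>-equations are then the graph equations.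
  For \<open>i \<le> k\<close> the \<open>p\<^sub>i\<close>-equation is \<open>\<beta>\<^sub>i = q'\<^sub>i\<close>, and the sum and difference of the
  \<open>\<beta>\<^sub>i\<close>- and \<open>q\<^sub>i\<close>-equations separate \<open>S\<^sup>+\<close> from \<open>S\<^sup>-\<close>.\<close>

lemma generating_equations_iff:
  assumes \<alpha>: "\<alpha> \<in> alpha_space k"
  shows "(\<forall>i. p' $ i = partial i (\<lambda>q. F_fam k lam Sp Sm p q \<alpha> \<beta>) q) \<and>
     (\<forall>i. q' $ i = - partial i (\<lambda>p. F_fam k lam Sp Sm p q \<alpha> \<beta>) p) \<and>
     (\<forall>j\<in>- idx k. partial j (\<lambda>\<alpha>. F_fam k lam Sp Sm p q \<alpha> \<beta>) \<alpha> = 0) \<and>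
     (\<forall>i. partial i (\<lambda>\<beta>. F_fam k lam Sp Sm p q \<alpha> \<beta>) \<beta> = 0) \<longleftrightarrow>
     \<alpha> = mix k 0 p' \<and> \<beta> = q' \<and>
     head lam ((p, q), (p', q')) \<in> graph_q Sp \<and> tail lam ((p, q), (p', q')) \<in> graph_mix k Sm"
    (is "?equations \<longleftrightarrow> ?params \<and> ?\<beta> \<and> ?head \<and> ?tail")
proof -
  define P where "P i = lam * partial i Sp (plus_arg lam q \<beta>)" for i
  define M where "M i = (1 - lam) * partial i Sm (minus_arg k lam p q \<alpha> \<beta>)" for i
  have equations: "?equations \<longleftrightarrow>
      (\<forall>i. if i \<in> idx k
        then p' $ i = P i - M i \<and> q' $ i = \<beta> $ i \<and> P i + M i - p $ i = 0
        else p' $ i = P i + (\<alpha> $ i - p $ i) / 2 \<and> q' $ i = M i + (\<beta> $ i + q $ i) / 2 \<and>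
          M i + (q $ i - \<beta> $ i) / 2 = 0 \<and> P i - (p $ i + \<alpha> $ i) / 2 = 0)"
    unfolding partial_q_F_fam partial_p_F_fam partial_\<alpha>_F_fam partial_\<beta>_F_fam P_def M_def
    by (auto simp: field_simps split: if_splits)
  have params: "?params \<longleftrightarrow> (\<forall>i\<in>- idx k. \<alpha> $ i = p' $ i)"
    using \<alpha> by (auto simp: alpha_space_def mix_def vec_eq_iff)
  have graphs: "?head \<and> ?tail \<longleftrightarrow>
      (\<forall>i. P i = (p $ i + p' $ i) / 2 \<and>
        (if i \<in> idx k then M i = (p $ i - p' $ i) / 2 else M i = - (q $ i - q' $ i) / 2))"
    if ?params ?\<beta>
  proof -
    have plus: "(q + q') /\<^sub>R (2 * lam) = plus_arg lam q \<beta>"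
      using that by (simp add: plus_arg_def)
    have minus: "mix k ((q - q') /\<^sub>R (2 * (1 - lam))) ((p - p') /\<^sub>R (2 * (1 - lam))) =
        minus_arg k lam p q \<alpha> \<beta>"
      using that by (simp add: minus_arg_def mix_def vec_eq_iff)
    have rescale: "(inverse (2 * c) * x = D) = (c * D = x / 2)" if "c \<noteq> 0" for c x D :: real
      using that by (auto simp: field_simps)
    have "?head \<longleftrightarrow> (\<forall>i. inverse (2 * lam) * (p $ i + p' $ i) = partial i Sp (plus_arg lam q \<beta>))"
      unfolding head_def graph_q_def prod.case add_Pair scaleR_Pair mem_Collect_eq plus by simp
    moreover have "?tail \<longleftrightarrow>
        (\<forall>i\<in>idx k. inverse (2 * (1 - lam)) * (p $ i - p' $ i) =
          partial i Sm (minus_arg k lam p q \<alpha> \<beta>)) \<and>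
        (\<forall>i\<in>- idx k. inverse (2 * (1 - lam)) * (q $ i - q' $ i) =
          - partial i Sm (minus_arg k lam p q \<alpha> \<beta>))"
      unfolding tail_def graph_mix_def prod.case diff_Pair scaleR_Pair mem_Collect_eq minus by simp
    moreover have "1 - lam \<noteq> 0"
      using lam by simp
    ultimately have "?head \<and> ?tail \<longleftrightarrow>
        (\<forall>i. P i = (p $ i + p' $ i) / 2) \<and>
        (\<forall>i\<in>idx k. M i = (p $ i - p' $ i) / 2) \<and>
        (\<forall>i\<in>- idx k. - M i = (q $ i - q' $ i) / 2)"
      using \<open>lam \<noteq> 0\<close> \<open>1 - lam \<noteq> 0\<close> by (simp only: rescale P_def M_def mult_minus_right)
    also have "\<dots> \<longleftrightarrow> (\<forall>i. P i = (p $ i + p' $ i) / 2 \<and>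
        (if i \<in> idx k then M i = (p $ i - p' $ i) / 2 else M i = - (q $ i - q' $ i) / 2))"
    proof -
      have "(- x = y / 2) = (x = - y / 2)" for x y :: real
        by auto
      then show ?thesis
        by (simp only:) auto
    qed
    finally show ?thesis .
  qed
  show ?thesis
  proof
    assume E: ?equations
    have low: "p' $ i = P i - M i" "q' $ i = \<beta> $ i" "P i + M i - p $ i = 0" if "i \<in> idx k" for i
      using E[unfolded equations, rule_format, of i] that by (auto simp only: if_True)
    have high: "p' $ i = P i + (\<alpha> $ i - p $ i) / 2" "q' $ i = M i + (\<beta> $ i + q $ i) / 2"
      "M i + (q $ i - \<beta> $ i) / 2 = 0" "P i - (p $ i + \<alpha> $ i) / 2 = 0" if "i \<notin> idx k" for i
      using E[unfolded equations, rule_format, of i] that by (auto simp only: if_False)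
    have \<beta>: "\<beta> $ i = q' $ i" for i
      using low(2)[of i] high(2,3)[of i] by (cases "i \<in> idx k") argo+
    have \<alpha>: "\<alpha> $ i = p' $ i" if "i \<notin> idx k" for i
      using high(1,4)[OF that] by argo
    have ?params
      unfolding params using \<alpha> by simp
    moreover have ?\<beta>
      using \<beta> by (simp add: vec_eq_iff)
    moreover have "?head \<and> ?tail"
      unfolding graphs[OF \<open>?params\<close> \<open>?\<beta>\<close>]
    proof
      show "P i = (p $ i + p' $ i) / 2 \<and>
          (if i \<in> idx k then M i = (p $ i - p' $ i) / 2 else M i = - (q $ i - q' $ i) / 2)" for i
      proof (cases "i \<in> idx k")
        case True
        then show ?thesis
          using low[OF True] by (simp only: if_True) argo
      next
        case False
        then show ?thesis
          using high[OF False] \<alpha>[OF False] \<beta>[of i] by (simp only: if_False) argo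
      qed
    qed
    ultimately show "?params \<and> ?\<beta> \<and> ?head \<and> ?tail"
      by blast
  next
    assume R: "?params \<and> ?\<beta> \<and> ?head \<and> ?tail"
    then have G: "P i = (p $ i + p' $ i) / 2"
      "if i \<in> idx k then M i = (p $ i - p' $ i) / 2 else M i = - (q $ i - q' $ i) / 2" for i
      using graphs by blast+
    have \<alpha>: "\<alpha> $ i = p' $ i" if "i \<notin> idx k" for i
      using R that unfolding params by simp
    have \<beta>: "\<beta> $ i = q' $ i" for i
      using R by simp
    show ?equations
      unfolding equations
    proof
      show "if i \<in> idx k
        then p' $ i = P i - M i \<and> q' $ i = \<beta> $ i \<and> P i + M i - p $ i = 0
        else p' $ i = P i + (\<alpha> $ i - p $ i) / 2 \<and> q' $ i = M i + (\<beta> $ i + q $ i) / 2 \<and>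
          M i + (q $ i - \<beta> $ i) / 2 = 0 \<and> P i - (p $ i + \<alpha> $ i) / 2 = 0" for i
      proof (cases "i \<in> idx k")
        case True
        then have "M i = (p $ i - p' $ i) / 2"
          using G(2)[of i] by simp
        then show ?thesis
          using G(1)[of i] \<beta>[of i] True by simp
      next
        case False
        then have "M i = - (q $ i - q' $ i) / 2"
          using G(2)[of i] by simp
        then show ?thesis
          using G(1)[of i] \<alpha>[OF False] \<beta>[of i] False by (simp only: if_False) argo
      qed
    qed
  qed
qed

end

lemma continuous_on_mix [continuous_intros]:
  assumes "continuous_on A f" "continuous_on A g"
  shows "continuous_on A (\<lambda>x. mix k (f x) (g x))"
  unfolding mix_def
proof (rule continuous_on_vec_lambda)
  show "continuous_on A (\<lambda>x. if i \<in> idx k then f x $ i else g x $ i)" for i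
    using assms by (cases "i \<in> idx k") (auto intro: continuous_on_component)
qed

text \<open>The arguments of \<open>F\<^sub>\<lambda>\<close> at which the generating equations can produce a given point of the tangent
  bundle.\<close>

definition fibre_params ::
    "nat \<Rightarrow> 'm::{finite,linorder} phase \<times> 'm phase \<Rightarrow> 'm rvec \<times> 'm rvec \<times> 'm rvec \<times> 'm rvec" where
  "fibre_params k z = (fst (fst z), snd (fst z), mix k 0 (fst (snd z)), snd (snd z))"

lemma continuous_on_fibre_params: "continuous_on A (fibre_params k)"
  unfolding fibre_params_def by (intro continuous_intros)

lemma generated_set_F_fam:
  assumes lam: "lam \<noteq> 0" "lam \<noteq> 1"
    and diff: "\<And>p q \<alpha> \<beta>. (p, q, \<alpha>, \<beta>) \<in> W \<Longrightarrow>
      Sp differentiable (at (plus_arg lam q \<beta>)) \<and> Sm differentiable (at (minus_arg k lam p q \<alpha> \<beta>))"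
  shows "generated_set k (F_fam k lam Sp Sm) W =
    head lam -` graph_q Sp \<inter> tail lam -` graph_mix k Sm \<inter> fibre_params k -` W"
proof (rule set_eqI)
  fix z :: "'a phase \<times> 'a phase"
  obtain p q p' q' where z: "z = ((p, q), (p', q'))"
    by (metis prod.collapse)
  have "z \<in> generated_set k (F_fam k lam Sp Sm) W \<longleftrightarrow>
      (\<exists>\<alpha>\<in>alpha_space k. \<exists>\<beta>. (p, q, \<alpha>, \<beta>) \<in> W \<and> \<alpha> = mix k 0 p' \<and> \<beta> = q' \<and>
        head lam z \<in> graph_q Sp \<and> tail lam z \<in> graph_mix k Sm)"
    unfolding z generated_set_def mem_Collect_eq prod.case
  proof (rule bex_cong[OF refl], rule ex_cong1, rule conj_cong[OF refl])
    fix \<alpha> \<beta> :: "'a rvec"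
    assume "\<alpha> \<in> alpha_space k" "(p, q, \<alpha>, \<beta>) \<in> W"
    then show "(\<forall>i. p' $ i = partial i (\<lambda>q. F_fam k lam Sp Sm p q \<alpha> \<beta>) q) \<and>
        (\<forall>i. q' $ i = - partial i (\<lambda>p. F_fam k lam Sp Sm p q \<alpha> \<beta>) p) \<and>
        (\<forall>j\<in>- idx k. partial j (\<lambda>\<alpha>. F_fam k lam Sp Sm p q \<alpha> \<beta>) \<alpha> = 0) \<and>
        (\<forall>i. partial i (\<lambda>\<beta>. F_fam k lam Sp Sm p q \<alpha> \<beta>) \<beta> = 0) \<longleftrightarrow>
        \<alpha> = mix k 0 p' \<and> \<beta> = q' \<and>
        head lam ((p, q), (p', q')) \<in> graph_q Sp \<and> tail lam ((p, q), (p', q')) \<in> graph_mix k Sm"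
      using diff by (intro generating_equations_iff lam) auto
  qed
  moreover have "mix k 0 p' \<in> alpha_space k"
    by (simp add: mix_def alpha_space_def)
  ultimately show "z \<in> generated_set k (F_fam k lam Sp Sm) W \<longleftrightarrow>
      z \<in> head lam -` graph_q Sp \<inter> tail lam -` graph_mix k Sm \<inter> fibre_params k -` W"
    by (auto simp: z fibre_params_def)
qed

theorem theorem3p7:
  fixes L Lp Lm :: "'m::{finite,linorder} phase set"
    and ap am a a' :: "'m phase"
    and Sp Sm :: "'m rvec \<Rightarrow> real"
    and lam :: real and k :: nat
  assumes "lagrangian_submanifold L" and "closed L"
    and "lam \<noteq> 0" and "lam \<noteq> 1"
    and "k_parallel k L ap am"
    and "set_germ_eq ap Lp L" and "set_germ_eq am Lm L"
    and "smooth_germ_at (snd ap) Sp"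
    and "smooth_germ_at (mix k (snd am) (fst am)) Sm"
    and "set_germ_eq ap Lp (graph_q Sp)"
    and "set_germ_eq am Lm (graph_mix k Sm)"
    and "\<And>u v. second_differential Sp (snd ap) u v = 0"
    and "\<And>u v. second_differential Sm (mix k (snd am) (fst am)) u v = 0"
    and "a = lam *\<^sub>R ap + (1 - lam) *\<^sub>R am"
    and "a' = lam *\<^sub>R ap - (1 - lam) *\<^sub>R am"
  shows "generates_germ k (F_fam k lam Sp Sm) (fst a, snd a, mix k 0 (fst a'), snd a')
           (chord_map lam ` (Lp \<times> Lm)) (a, a')"
proof -
  note lam = \<open>lam \<noteq> 0\<close> \<open>lam \<noteq> 1\<close>
  have aa': "(a, a') = chord_map lam (ap, am)"
    using assms(14,15) by (simp add: chord_map_def)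
  have head: "head lam (a, a') = ap" and tail: "tail lam (a, a') = am"
    unfolding aa' using lam by (simp_all add: head_chord_map tail_chord_map)
  obtain Up where Up: "open Up" "snd ap \<in> Up" "\<And>x. x \<in> Up \<Longrightarrow> Sp differentiable (at x)"
    using assms(8) smooth_on_imp_differentiable unfolding smooth_germ_at_def by metis
  obtain Um where Um: "open Um" "mix k (snd am) (fst am) \<in> Um"
      "\<And>x. x \<in> Um \<Longrightarrow> Sm differentiable (at x)"
    using assms(9) smooth_on_imp_differentiable unfolding smooth_germ_at_def by metis
  \<comment> \<open>The arguments of \<open>S\<^sup>+\<close> and \<open>S\<^sup>-\<close> in \<open>F\<^sub>\<lambda>\<close>; at the base point of the family they are the points
    that correspond to \<open>a\<^sup>+\<close> and \<open>a\<^sup>-\<close>.\<close>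
  define args where
    "args = (\<lambda>(p, q, \<alpha>, \<beta>). (plus_arg lam q \<beta>, minus_arg k lam p q \<alpha> \<beta>) :: 'm rvec \<times> 'm rvec)"
  define W0 where "W0 = args -` (Up \<times> Um)"
  have "continuous_on UNIV args"
    unfolding args_def case_prod_unfold plus_arg_def minus_arg_def by (intro continuous_intros)
  then have "open W0"
    unfolding W0_def using Up(1) Um(1) by (intro open_vimage open_Times)
  have "plus_arg lam (snd a) (snd a') = snd (head lam (a, a'))"
    by (simp add: plus_arg_def head_def)
  moreover have "minus_arg k lam (fst a) (snd a) (mix k 0 (fst a')) (snd a') =
      mix k (snd (tail lam (a, a'))) (fst (tail lam (a, a')))"
    by (simp add: minus_arg_def tail_def mix_def vec_eq_iff)
  ultimately have "fibre_params k (a, a') \<in> W0"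
    using Up(2) Um(2) by (simp add: W0_def args_def fibre_params_def head tail)
  have germ: "set_germ_eq (a, a') (chord_map lam ` (Lp \<times> Lm)) (generated_set k (F_fam k lam Sp Sm) W)"
    if W: "open W" "fibre_params k (a, a') \<in> W" "W \<subseteq> W0" for W
  proof -
    have generated: "generated_set k (F_fam k lam Sp Sm) W =
        head lam -` graph_q Sp \<inter> tail lam -` graph_mix k Sm \<inter> fibre_params k -` W"
      using W(3) Up(3) Um(3) by (intro generated_set_F_fam lam) (auto simp: W0_def args_def)
    have "\<forall>\<^sub>F z in nhds (a, a'). z \<in> head lam -` Lp \<longleftrightarrow> z \<in> head lam -` graph_q Sp"
      using set_germ_eq_vimage[OF continuous_on_head] assms(10)
      unfolding head[symmetric] set_germ_eq_def by blast
    moreover have "\<forall>\<^sub>F z in nhds (a, a'). z \<in> tail lam -` Lm \<longleftrightarrow> z \<in> tail lam -` graph_mix k Sm"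
      using set_germ_eq_vimage[OF continuous_on_tail] assms(11)
      unfolding tail[symmetric] set_germ_eq_def by blast
    moreover have "\<forall>\<^sub>F z in nhds (a, a'). z \<in> fibre_params k -` W"
      using W by (intro eventually_nhds_in_open open_vimage continuous_on_fibre_params) auto
    ultimately show ?thesis
      unfolding set_germ_eq_def chord_map_image[OF lam] generated by eventually_elim simp
  qed
  show ?thesis
    unfolding generates_germ_def
    using \<open>open W0\<close> \<open>fibre_params k (a, a') \<in> W0\<close> germ
    by (intro exI[of _ W0]) (auto simp: fibre_params_def)
qed

end
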